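(* Let $\Gamma\in\mathcal{H}$ and let $f\in P^\Gamma$. Then $\Gamma$ is the homothety type of a generalized rotation set of $f$.
   Context: $\mathbb{T}^2=\mathbb{R}^2/\mathbb{Z}^2$, $R_\theta(x)=x+\theta$; $\overline{\mathcal{O}}^{\infty}(\mathbb{T}^2)$ is the $C^\infty$-closure of $\{h\circ R_\theta\circ h^{-1}: h\in\mathrm{Diff}^\infty(\mathbb{T}^2),\theta\in\mathbb{T}^2\}$. $\mathcal{H}$ is the set of non-empty compact subsets of $\mathbb{R}^2$ modulo translations and positive-ratio homotheties. $d_H$ is the Hausdorff distance. For $r>0$, $K\in\mathcal{LA}_r(\Gamma)$ means $\mathrm{diam}(K)>r$ and some $\hat\Gamma\in\Gamma$ of diameter $1$ satisfies $d_H(K/\mathrm{diam}(K),\hat\Gamma)<1/r$. Let $D=[0,1]^2$ and fix $\tilde x_0\in D$. For $k\in\mathbb{N}^*$, $P_k^\Gamma=\{f\in\overline{\mathcal{O}}^{\infty}(\mathbb{T}^2): \exists n\in\mathbb{N}^*,\ \tilde f^n(D)\in\mathcal{LA}_k(\Gamma)\}$, where $\tilde f$ is a lift of $f$ (the condition does not depend on the lift), and $P^\Gamma=\bigcap_{k\ge1}P_k^\Gamma$. For a lift $\tilde f$ of $f$, a generalized rotation set of $f$ is a Hausdorff limit $\lim_{i}\frac{\tilde f^{n_i}(D)-\tilde f^{n_i}(\tilde x_0)}{\mathrm{diam}(\tilde f^{n_i}(D))}$ along some sequence of natural numbers $(n_i)$ with $\mathrm{diam}(\tilde f^{n_i}(D))\to+\infty$.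 *)

theory Defs
  imports "HOL-Analysis.Analysis"
begin

section \<open>Integer lattice, lifts of torus maps\<close>

definition Z2 :: "(real^2) set" where
  "Z2 = {m. \<forall>i. m $ i \<in> \<int>}"

text \<open>Iterated directional (Frechet) derivatives of a map of the plane.\<close>
fun dirderiv :: "(real^2 \<Rightarrow> real^2) \<Rightarrow> (real^2) list \<Rightarrow> real^2 \<Rightarrow> real^2" where
  "dirderiv F [] = F"
| "dirderiv F (v # vs) = (\<lambda>x. frechet_derivative (dirderiv F vs) (at x) v)"

text \<open>C-infinity: all iterated derivatives exist everywhere.\<close>
definition smooth_map :: "(real^2 \<Rightarrow> real^2) \<Rightarrow> bool" where
  "smooth_map F \<longleftrightarrow> (\<forall>vs x. dirderiv F vs differentiable (at x))"

text \<open>Lifts to the plane of C-infinity diffeomorphisms of the torus R^2/Z^2: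
  C-infinity diffeomorphisms of R^2 such that both the map and its inverse
  descend to the torus.\<close>
definition torus_diffeo_lift :: "(real^2 \<Rightarrow> real^2) \<Rightarrow> bool" where
  "torus_diffeo_lift H \<longleftrightarrow> bij H \<and> smooth_map H \<and> smooth_map (inv H) \<and>
     (\<forall>x m. m \<in> Z2 \<longrightarrow> H (x + m) - H x \<in> Z2) \<and>
     (\<forall>x m. m \<in> Z2 \<longrightarrow> inv H (x + m) - inv H x \<in> Z2)"

text \<open>F is a lift of an element of the C-infinity closure of the set of maps
  conjugate (by torus diffeomorphisms) to rotations: F is the C-infinity limit
  (uniform convergence of all derivatives) of lifts of such conjugates.
  The lifts of h o R_theta o h^-1 are exactly the maps H o (+t) o H^-1.\<close>
definition in_Obar_lift :: "(real^2 \<Rightarrow> real^2) \<Rightarrow> bool" where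
  "in_Obar_lift F \<longleftrightarrow>
     (\<exists>H :: nat \<Rightarrow> real^2 \<Rightarrow> real^2. \<exists>t :: nat \<Rightarrow> real^2.
        (\<forall>n. torus_diffeo_lift (H n)) \<and>
        (\<forall>vs. uniform_limit UNIV
                (\<lambda>n. dirderiv (H n \<circ> (\<lambda>x. x + t n) \<circ> inv (H n)) vs)
                (dirderiv F vs) sequentially))"

section \<open>Hausdorff distance, homothety classes\<close>

definition hausdorff_dist :: "(real^2) set \<Rightarrow> (real^2) set \<Rightarrow> real" where
  "hausdorff_dist A B = max (SUP a\<in>A. infdist a B) (SUP b\<in>B. infdist b A)"

definition homothety_class :: "(real^2) set \<Rightarrow> (real^2) set set" where
  "homothety_class K = {L. \<exists>c v. c > 0 \<and> L = (\<lambda>x. v + c *\<^sub>R x) ` K}"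

text \<open>The space H: classes of non-empty compact sets modulo translations and
  positive homotheties.\<close>
definition homothety_types :: "(real^2) set set set" where
  "homothety_types = {homothety_class K | K. compact K \<and> K \<noteq> {}}"

definition normalize :: "(real^2) set \<Rightarrow> (real^2) set" where
  "normalize K = (\<lambda>x. (1 / diameter K) *\<^sub>R x) ` K"

definition LA :: "real \<Rightarrow> (real^2) set set \<Rightarrow> (real^2) set set" where
  "LA r \<Gamma> = {K. diameter K > r \<and>
      (\<exists>G\<in>\<Gamma>. diameter G = 1 \<and> hausdorff_dist (normalize K) G < 1 / r)}"

definition D :: "(real^2) set" where
  "D = cbox 0 1"

definition P_k :: "nat \<Rightarrow> (real^2) set set \<Rightarrow> (real^2 \<Rightarrow> real^2) \<Rightarrow> bool" where
  "P_k k \<Gamma> F \<longleftrightarrow> in_Obar_lift F \<and> (\<exists>n\<ge>1. (F ^^ n) ` D \<in> LA (real k) \<Gamma>)"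

definition P :: "(real^2) set set \<Rightarrow> (real^2 \<Rightarrow> real^2) \<Rightarrow> bool" where
  "P \<Gamma> F \<longleftrightarrow> (\<forall>k\<ge>1. P_k k \<Gamma> F)"

text \<open>Generalized rotation set (w.r.t. the lift F and base point x0).\<close>
definition generalized_rotation_set ::
    "(real^2 \<Rightarrow> real^2) \<Rightarrow> real^2 \<Rightarrow> (real^2) set \<Rightarrow> bool" where
  "generalized_rotation_set F x0 L \<longleftrightarrow> compact L \<and> L \<noteq> {} \<and>
     (\<exists>n :: nat \<Rightarrow> nat.
        filterlim (\<lambda>i. diameter ((F ^^ n i) ` D)) at_top sequentially \<and>
        ((\<lambda>i. hausdorff_dist
               ((\<lambda>y. (1 / diameter ((F ^^ n i) ` D)) *\<^sub>R (y - (F ^^ n i) x0)) ` ((F ^^ n i) ` D))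
               L) \<longlonglongrightarrow> 0))"

end

theory Submission
  imports Defs
begin

text \<open>
  Membership of \<open>F\<close> in \<open>P_k\<close> produces an iterate whose normalized image is
  \<open>1/k\<close>-close to a diameter-one representative of \<open>\<Gamma>\<close>; all such representatives are
  translates of one fixed rescaling \<open>c K\<close>. Recentring at the image of \<open>x0\<close> only
  translates, so the rescaled iterates are \<open>1/k\<close>-close to translates \<open>t_k + c K\<close>.
  They all contain \<open>0\<close>, hence the \<open>t_k\<close> stay bounded, and along a subsequence
  \<open>t_k \<rightarrow> u\<close>: the rescaled iterates converge to \<open>u + c K\<close>, whose homothety class
  is \<open>\<Gamma>\<close>.
\<close>

lemma bdd_above_infdist_image:
  fixes A B :: "'a::metric_space set"
  assumes "bounded A" "B \<noteq> {}"
  shows "bdd_above ((\<lambda>a. infdist a B) ` A)"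
proof -
  obtain b where b: "b \<in> B" using assms(2) by blast
  obtain c R where R: "\<And>a. a \<in> A \<Longrightarrow> dist c a \<le> R" using assms(1) unfolding bounded_def by blast
  have "infdist a B \<le> R + dist c b" if "a \<in> A" for a
  proof -
    have "infdist a B \<le> dist a b" by (rule infdist_le[OF b])
    also have "\<dots> \<le> dist c a + dist c b" by (rule dist_triangle3)
    finally show ?thesis using R[OF that] by linarith
  qed
  then show ?thesis by (auto simp: bdd_above_def)
qed

lemma hausdorff_dist_commute: "hausdorff_dist A B = hausdorff_dist B A"
  unfolding hausdorff_dist_def by (rule max.commute)

lemma infdist_le_hausdorff_dist:
  assumes "bounded A" "B \<noteq> {}" "x \<in> A"
  shows "infdist x B \<le> hausdorff_dist A B"
proof -
  have "infdist x B \<le> (SUP a\<in>A. infdist a B)"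
    by (rule cSUP_upper[OF assms(3) bdd_above_infdist_image[OF assms(1,2)]])
  then show ?thesis unfolding hausdorff_dist_def by simp
qed

lemma hausdorff_dist_nonneg:
  assumes "bounded A" "A \<noteq> {}" "B \<noteq> {}"
  shows "0 \<le> hausdorff_dist A B"
  using infdist_le_hausdorff_dist[OF assms(1,3)] assms(2) infdist_nonneg
  by (meson ex_in_conv order_trans)

lemma hausdorff_dist_less_imp_near:
  assumes "bounded A" "B \<noteq> {}" "hausdorff_dist A B < e" "x \<in> A"
  obtains y where "y \<in> B" "dist x y < e"
proof -
  have "infdist x B < e"
    using infdist_le_hausdorff_dist[OF assms(1,2,4)] assms(3) by linarith
  then show ?thesis
    using that infdist_notempty[OF assms(2)] cINF_less_iff[OF assms(2), of "dist x" e]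
    by (auto simp: bdd_below_def intro: zero_le_dist)
qed

lemma hausdorff_dist_le:
  assumes "A \<noteq> {}" "B \<noteq> {}"
    and "\<And>x. x \<in> A \<Longrightarrow> \<exists>y\<in>B. dist x y \<le> e"
    and "\<And>y. y \<in> B \<Longrightarrow> \<exists>x\<in>A. dist x y \<le> e"
  shows "hausdorff_dist A B \<le> e"
proof -
  have "(SUP a\<in>A. infdist a B) \<le> e"
    using assms(1,3) by (intro cSUP_least) (auto intro: infdist_le2)
  moreover have "(SUP b\<in>B. infdist b A) \<le> e"
    using assms(2,4) by (intro cSUP_least) (auto intro: infdist_le2 simp: dist_commute)
  ultimately show ?thesis unfolding hausdorff_dist_def by simp
qed

lemma hausdorff_dist_translation_le:
  assumes "bounded A" "bounded B" "A \<noteq> {}" "B \<noteq> {}"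
  shows "hausdorff_dist ((+) u ` A) ((+) v ` B) \<le> hausdorff_dist A B + norm (u - v)"
proof (rule field_le_epsilon)
  fix \<epsilon> :: real assume "0 < \<epsilon>"
  define e where "e = hausdorff_dist A B + \<epsilon>"
  have AB: "hausdorff_dist A B < e" and BA: "hausdorff_dist B A < e"
    using \<open>0 < \<epsilon>\<close> by (simp_all add: e_def hausdorff_dist_commute)
  have shift: "dist (u + a) (v + b) \<le> dist a b + norm (u - v)" for a b :: "real^2"
    using norm_triangle_ineq[of "a - b" "u - v"] by (simp add: dist_norm algebra_simps)
  show "hausdorff_dist ((+) u ` A) ((+) v ` B) \<le> hausdorff_dist A B + norm (u - v) + \<epsilon>"
  proof (rule hausdorff_dist_le)
    fix x assume "x \<in> (+) u ` A"
    then obtain a where a: "a \<in> A" "x = u + a" by blast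
    obtain b where "b \<in> B" "dist a b < e"
      using hausdorff_dist_less_imp_near[OF assms(1,4) AB a(1)] by blast
    then show "\<exists>y\<in>(+) v ` B. dist x y \<le> hausdorff_dist A B + norm (u - v) + \<epsilon>"
      using shift[of a b] a(2) by (intro bexI[of _ "v + b"]) (auto simp: e_def)
  next
    fix y assume "y \<in> (+) v ` B"
    then obtain b where b: "b \<in> B" "y = v + b" by blast
    obtain a where "a \<in> A" "dist b a < e"
      using hausdorff_dist_less_imp_near[OF assms(2,3) BA b(1)] by blast
    then show "\<exists>x\<in>(+) u ` A. dist x y \<le> hausdorff_dist A B + norm (u - v) + \<epsilon>"
      using shift[of a b] b(2) by (intro bexI[of _ "u + a"]) (auto simp: e_def dist_commute)
  qed (use assms in auto)
qed

lemma diameter_affine_image: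
  fixes K :: "'a::real_normed_vector set"
  assumes "bounded K" "c > 0"
  shows "diameter ((\<lambda>x. v + c *\<^sub>R x) ` K) = c * diameter K"
proof -
  let ?f = "\<lambda>x. v + c *\<^sub>R x"
  have bf: "bounded (?f ` K)"
    using bounded_translation[OF bounded_scaling[OF assms(1)], of v c] by (simp add: image_image)
  have nf: "norm (?f x - ?f y) = c * norm (x - y)" for x y
    using assms(2) by (simp flip: scaleR_diff_right)
  have df: "dist (?f x) (?f y) = c * dist x y" for x y
    using nf by (simp add: dist_norm)
  have "diameter (?f ` K) \<le> c * diameter K"
  proof (rule diameter_le)
    show "?f ` K \<noteq> {} \<or> 0 \<le> c * diameter K"
      using assms by (simp add: diameter_ge_0)
    fix x y assume "x \<in> ?f ` K" "y \<in> ?f ` K"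
    then show "norm (x - y) \<le> c * diameter K"
      using diameter_bounded_bound[OF assms(1)] assms(2) nf
      by (auto simp: dist_norm intro: mult_left_mono)
  qed
  moreover have "diameter K \<le> diameter (?f ` K) / c"
  proof (rule diameter_le)
    show "K \<noteq> {} \<or> 0 \<le> diameter (?f ` K) / c"
      using assms by (simp add: diameter_ge_0[OF bf])
    fix x y assume "x \<in> K" "y \<in> K"
    then have "c * dist x y \<le> diameter (?f ` K)"
      using diameter_bounded_bound[OF bf] df by (metis imageI)
    then show "norm (x - y) \<le> diameter (?f ` K) / c"
      using assms(2) by (simp add: field_simps dist_norm)
  qed
  ultimately show ?thesis
    using assms(2) by (simp add: field_simps)
qed

lemma homothety_class_affine_image:
  assumes "c > 0"
  shows "homothety_class ((\<lambda>x. w + c *\<^sub>R x) ` K) = homothety_class K"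
proof
  show "homothety_class ((\<lambda>x. w + c *\<^sub>R x) ` K) \<subseteq> homothety_class K"
  proof
    fix M assume "M \<in> homothety_class ((\<lambda>x. w + c *\<^sub>R x) ` K)"
    then obtain c' v where "c' > 0" and M: "M = (\<lambda>x. v + c' *\<^sub>R x) ` ((\<lambda>x. w + c *\<^sub>R x) ` K)"
      unfolding homothety_class_def by blast
    have "M = (\<lambda>x. (v + c' *\<^sub>R w) + (c' * c) *\<^sub>R x) ` K"
      unfolding M image_image by (simp add: algebra_simps)
    with \<open>c' > 0\<close> assms show "M \<in> homothety_class K"
      unfolding homothety_class_def by (blast intro: mult_pos_pos)
  qed
  show "homothety_class K \<subseteq> homothety_class ((\<lambda>x. w + c *\<^sub>R x) ` K)"
  proof
    fix M assume "M \<in> homothety_class K"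
    then obtain c' v where "c' > 0" and M: "M = (\<lambda>x. v + c' *\<^sub>R x) ` K"
      unfolding homothety_class_def by blast
    have "M = (\<lambda>x. (v - (c' / c) *\<^sub>R w) + (c' / c) *\<^sub>R x) ` ((\<lambda>x. w + c *\<^sub>R x) ` K)"
      unfolding M image_image using assms by (simp add: algebra_simps)
    with \<open>c' > 0\<close> assms show "M \<in> homothety_class ((\<lambda>x. w + c *\<^sub>R x) ` K)"
      unfolding homothety_class_def by (blast intro: divide_pos_pos)
  qed
qed

lemma homothety_class_diameter_1:
  assumes "G \<in> homothety_class K" "diameter G = 1" "bounded K"
  obtains v where "0 < diameter K" "G = (+) v ` (*\<^sub>R) (1 / diameter K) ` K"
proof -
  obtain c v where "c > 0" and G: "G = (\<lambda>x. v + c *\<^sub>R x) ` K"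
    using assms(1) unfolding homothety_class_def by blast
  then have "c * diameter K = 1"
    using assms(2,3) diameter_affine_image by metis
  then have "c = 1 / diameter K"
    by (metis mult_zero_right nonzero_eq_divide_eq zero_neq_one)
  moreover have "0 < diameter K"
    using zero_less_mult_pos[of c "diameter K"] \<open>c * diameter K = 1\<close> \<open>c > 0\<close> by simp
  ultimately show ?thesis
    using that G by (simp add: image_image)
qed

lemma smooth_map_continuous:
  assumes "smooth_map G"
  shows "continuous_on UNIV G"
proof -
  have "G differentiable at x" for x
    using assms unfolding smooth_map_def by (metis dirderiv.simps(1))
  then show ?thesis
    by (intro differentiable_imp_continuous_on differentiable_at_imp_differentiable_on) auto
qed

lemma in_Obar_lift_continuous:
  assumes "in_Obar_lift F"
  shows "continuous_on UNIV F"
proof -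
  obtain H :: "nat \<Rightarrow> real^2 \<Rightarrow> real^2" and t where
    H: "\<And>n. torus_diffeo_lift (H n)"
    and lim: "\<And>vs. uniform_limit UNIV (\<lambda>n. dirderiv (H n \<circ> (\<lambda>x. x + t n) \<circ> inv (H n)) vs)
                (dirderiv F vs) sequentially"
    using assms unfolding in_Obar_lift_def by blast
  have "continuous_on UNIV (H n \<circ> (\<lambda>x. x + t n) \<circ> inv (H n))" for n
  proof -
    have H_cont: "continuous_on UNIV (H n)" and inv_cont: "continuous_on UNIV (inv (H n))"
      using H[of n] smooth_map_continuous unfolding torus_diffeo_lift_def by auto
    have "continuous_on UNIV ((\<lambda>x. x + t n) \<circ> inv (H n))"
      by (intro continuous_on_compose inv_cont continuous_intros)
    then show ?thesis
      unfolding comp_assoc by (rule continuous_on_compose) (use H_cont continuous_on_subset in blast)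
  qed
  then show ?thesis
    using uniform_limit_theorem[OF _ lim[of "[]"]] by auto
qed

lemma continuous_on_funpow:
  fixes f :: "'a::topological_space \<Rightarrow> 'a"
  assumes "continuous_on UNIV f"
  shows "continuous_on UNIV (f ^^ n)"
proof (induction n)
  case (Suc n)
  then show ?case
    using continuous_on_compose[OF Suc continuous_on_subset[OF assms]] by simp
qed (simp add: continuous_on_id)

lemma hausdorff_dist_translates_convergent_subseq:
  fixes S :: "nat \<Rightarrow> (real^2) set" and K :: "(real^2) set"
  assumes K: "compact K" "K \<noteq> {}"
    and S: "\<And>j. bounded (S j)" "\<And>j. 0 \<in> S j"
    and close: "\<And>j. hausdorff_dist (S j) ((+) (t j) ` K) \<le> e j"
    and e: "e \<longlonglongrightarrow> 0"
  obtains r u where "strict_mono r" "(\<lambda>i. hausdorff_dist (S (r i)) ((+) u ` K)) \<longlonglongrightarrow> 0"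
proof -
  have bK: "bounded K" using K(1) by (rule compact_imp_bounded)
  obtain E where E: "\<And>j. e j \<le> E"
    using BseqE[OF convergent_imp_Bseq[OF convergentI[OF e]]] by (metis abs_le_D1 real_norm_def)
  obtain R where R: "\<And>k. k \<in> K \<Longrightarrow> norm k \<le> R"
    using bK bounded_iff by blast
  have "norm (t j) \<le> E + 1 + R" for j
  proof -
    have "hausdorff_dist (S j) ((+) (t j) ` K) < E + 1"
      using close[of j] E[of j] by linarith
    moreover have "(+) (t j) ` K \<noteq> {}"
      using K(2) by blast
    ultimately obtain y where "y \<in> (+) (t j) ` K" "dist 0 y < E + 1"
      using hausdorff_dist_less_imp_near S by metis
    then obtain k where "k \<in> K" "norm (t j + k) < E + 1"
      by auto
    then show ?thesis
      using R[of k] norm_triangle_ineq4[of "t j + k" k] by simp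
  qed
  then have "bounded (range t)"
    by (auto simp: bounded_iff)
  then obtain r u where r: "strict_mono r" and u: "(t \<circ> r) \<longlonglongrightarrow> u"
    using bounded_imp_convergent_subsequence by blast
  have bound: "hausdorff_dist (S (r i)) ((+) u ` K) \<le> e (r i) + norm (t (r i) - u)" for i
  proof -
    have "(+) (u - t (r i)) ` (+) (t (r i)) ` K = (+) u ` K"
      by (simp add: image_image)
    then have "hausdorff_dist (S (r i)) ((+) u ` K)
        \<le> hausdorff_dist (S (r i)) ((+) (t (r i)) ` K) + norm (0 - (u - t (r i)))"
      using hausdorff_dist_translation_le[of "S (r i)" "(+) (t (r i)) ` K" 0 "u - t (r i)"]
        S K(2) bounded_translation[OF bK]
      by (auto simp: ex_in_conv)
    then show ?thesis
      using close[of "r i"] by (simp add: norm_minus_commute)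
  qed
  have "(\<lambda>i. hausdorff_dist (S (r i)) ((+) u ` K)) \<longlonglongrightarrow> 0"
  proof (rule tendsto_sandwich[OF _ _ tendsto_const])
    show "\<forall>\<^sub>F i in sequentially. 0 \<le> hausdorff_dist (S (r i)) ((+) u ` K)"
      using S(2) K(2) by (intro always_eventually allI hausdorff_dist_nonneg S(1)) auto
    show "\<forall>\<^sub>F i in sequentially. hausdorff_dist (S (r i)) ((+) u ` K) \<le> e (r i) + norm (t (r i) - u)"
      using bound by simp
    have "(\<lambda>i. e (r i)) \<longlonglongrightarrow> 0"
      using LIMSEQ_subseq_LIMSEQ[OF e r] by (simp add: comp_def)
    moreover have "(\<lambda>i. norm (t (r i) - u)) \<longlonglongrightarrow> 0"
      using tendsto_norm_zero[OF LIM_zero[OF u]] by (simp add: comp_def)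
    ultimately show "(\<lambda>i. e (r i) + norm (t (r i) - u)) \<longlonglongrightarrow> 0"
      by (rule tendsto_add_zero)
  qed
  with r show ?thesis by (rule that)
qed

definition rescaled_iterate :: "(real^2 \<Rightarrow> real^2) \<Rightarrow> real^2 \<Rightarrow> nat \<Rightarrow> (real^2) set" where
  "rescaled_iterate F x0 n =
     (\<lambda>y. (1 / diameter ((F ^^ n) ` D)) *\<^sub>R (y - (F ^^ n) x0)) ` (F ^^ n) ` D"

lemma generalized_rotation_set_iff:
  "generalized_rotation_set F x0 L \<longleftrightarrow> compact L \<and> L \<noteq> {} \<and>
     (\<exists>n. filterlim (\<lambda>i. diameter ((F ^^ n i) ` D)) at_top sequentially \<and>
          (\<lambda>i. hausdorff_dist (rescaled_iterate F x0 (n i)) L) \<longlonglongrightarrow> 0)"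
  unfolding generalized_rotation_set_def rescaled_iterate_def ..

lemma rescaled_iterate_eq_translate_normalize:
  "rescaled_iterate F x0 n =
     (+) (- ((1 / diameter ((F ^^ n) ` D)) *\<^sub>R (F ^^ n) x0)) ` normalize ((F ^^ n) ` D)"
  unfolding rescaled_iterate_def normalize_def image_image by (simp add: algebra_simps)

lemma zero_in_rescaled_iterate: "x0 \<in> D \<Longrightarrow> 0 \<in> rescaled_iterate F x0 n"
  unfolding rescaled_iterate_def by force

lemma zero_in_D: "0 \<in> D"
  by (simp add: D_def mem_box_cart)

lemma compact_iterate_image:
  fixes F :: "real^2 \<Rightarrow> real^2"
  assumes "continuous_on UNIV F"
  shows "compact ((F ^^ n) ` D)"
  using continuous_on_subset[OF continuous_on_funpow[OF assms]]
  by (intro compact_continuous_image) (auto simp: D_def)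

lemma compact_rescaled_iterate:
  assumes "continuous_on UNIV F"
  shows "compact (rescaled_iterate F x0 n)"
proof -
  have "compact ((F ^^ n) ` D)"
    using assms by (rule compact_iterate_image)
  then show ?thesis
    unfolding rescaled_iterate_def by (rule compact_continuous_image[rotated]) (intro continuous_intros)
qed

lemma P_imp_continuous: "P \<Gamma> F \<Longrightarrow> continuous_on UNIV F"
  unfolding P_def P_k_def using in_Obar_lift_continuous by blast

lemma P_imp_approximating_rescaled_iterates:
  assumes "P \<Gamma> F" "\<Gamma> = homothety_class K" "bounded K"
  obtains c n t where "c > 0" "\<And>j. real j < diameter ((F ^^ n j) ` D)"
    "\<And>j. hausdorff_dist (rescaled_iterate F x0 (n j)) ((+) (t j) ` (*\<^sub>R) c ` K) < 1 / real (Suc j)"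
proof -
  define c where "c = 1 / diameter K"
  have "\<exists>n t. 0 < c \<and> real j < diameter ((F ^^ n) ` D) \<and>
          hausdorff_dist (rescaled_iterate F x0 n) ((+) t ` (*\<^sub>R) c ` K) < 1 / real (Suc j)" for j
  proof -
    have "P_k (Suc j) \<Gamma> F"
      using assms(1) by (simp add: P_def)
    then obtain n G where n: "real (Suc j) < diameter ((F ^^ n) ` D)" and "G \<in> \<Gamma>" "diameter G = 1"
      and close: "hausdorff_dist (normalize ((F ^^ n) ` D)) G < 1 / real (Suc j)"
      unfolding P_k_def LA_def by auto
    then obtain v where "0 < diameter K" and G: "G = (+) v ` (*\<^sub>R) c ` K"
      using homothety_class_diameter_1 assms(2,3) unfolding c_def by blast
    define a where "a = (1 / diameter ((F ^^ n) ` D)) *\<^sub>R (F ^^ n) x0"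
    have bounded_normalize: "bounded (normalize ((F ^^ n) ` D))"
      unfolding normalize_def using compact_iterate_image[OF P_imp_continuous[OF assms(1)]]
      by (intro compact_imp_bounded compact_scaling)
    have "D \<noteq> {}"
      using zero_in_D by blast
    have "hausdorff_dist (rescaled_iterate F x0 n) ((+) (v - a) ` (*\<^sub>R) c ` K)
        = hausdorff_dist ((+) (- a) ` normalize ((F ^^ n) ` D)) ((+) (- a) ` G)"
      unfolding rescaled_iterate_eq_translate_normalize a_def G image_image
      by (simp add: algebra_simps)
    also have "\<dots> \<le> hausdorff_dist (normalize ((F ^^ n) ` D)) G + norm (- a - - a)"
      using \<open>diameter G = 1\<close> \<open>D \<noteq> {}\<close> assms(3)
      by (intro hausdorff_dist_translation_le bounded_normalize)
        (auto simp: G normalize_def intro!: bounded_translation bounded_scaling)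
    finally have "hausdorff_dist (rescaled_iterate F x0 n) ((+) (v - a) ` (*\<^sub>R) c ` K)
        \<le> hausdorff_dist (normalize ((F ^^ n) ` D)) G"
      by simp
    with n close \<open>0 < diameter K\<close> show ?thesis
      unfolding c_def by (intro exI[of _ n] exI[of _ "v - a"]) auto
  qed
  then obtain n t where "0 < c" "\<And>j. real j < diameter ((F ^^ n j) ` D)"
    "\<And>j. hausdorff_dist (rescaled_iterate F x0 (n j)) ((+) (t j) ` (*\<^sub>R) c ` K) < 1 / real (Suc j)"
    by metis
  then show ?thesis
    using that by blast
qed

theorem mainTheorem8:
  fixes \<Gamma> :: "(real^2) set set" and F :: "real^2 \<Rightarrow> real^2" and x0 :: "real^2"
  assumes "\<Gamma> \<in> homothety_types"
    and "x0 \<in> D"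
    and "P \<Gamma> F"
  shows "\<exists>L. generalized_rotation_set F x0 L \<and> homothety_class L = \<Gamma>"
proof -
  obtain K where K: "compact K" "K \<noteq> {}" and \<Gamma>: "\<Gamma> = homothety_class K"
    using assms(1) unfolding homothety_types_def by blast
  obtain c n t where "c > 0" and n: "\<And>j. real j < diameter ((F ^^ n j) ` D)"
    and close: "\<And>j. hausdorff_dist (rescaled_iterate F x0 (n j)) ((+) (t j) ` (*\<^sub>R) c ` K)
                  < 1 / real (Suc j)"
    using P_imp_approximating_rescaled_iterates[OF assms(3) \<Gamma> compact_imp_bounded[OF K(1)]] by blast
  obtain r u where r: "strict_mono r"
    and lim: "(\<lambda>i. hausdorff_dist (rescaled_iterate F x0 (n (r i))) ((+) u ` (*\<^sub>R) c ` K)) \<longlonglongrightarrow> 0"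
    using hausdorff_dist_translates_convergent_subseq[OF compact_scaling[OF K(1)] _
        compact_imp_bounded[OF compact_rescaled_iterate[OF P_imp_continuous[OF assms(3)]]]
        zero_in_rescaled_iterate[OF assms(2)] less_imp_le[OF close] LIMSEQ_Suc[OF lim_inverse_n']]
      K(2) by blast
  have "real i \<le> diameter ((F ^^ n (r i)) ` D)" for i
    using seq_suble[OF r, of i] n[of "r i"] by linarith
  then have "filterlim (\<lambda>i. diameter ((F ^^ n (r i)) ` D)) at_top sequentially"
    by (intro filterlim_at_top_mono[OF filterlim_real_sequentially]) auto
  then have "generalized_rotation_set F x0 ((+) u ` (*\<^sub>R) c ` K)"
    unfolding generalized_rotation_set_iff using lim K
    by (intro conjI exI[of _ "n \<circ> r"] compact_translation compact_scaling) auto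
  moreover have "homothety_class ((+) u ` (*\<^sub>R) c ` K) = \<Gamma>"
    using homothety_class_affine_image[OF \<open>c > 0\<close>, of u K] \<Gamma> by (simp add: image_image)
  ultimately show ?thesis by blast
qed

end
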